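(* Let $\mathcal{H}\subseteq\mathbb{C}^n$ be an $\epsilon$-robust hitting set for $V(n,s,r)$. For each $v=a+\iota b\in\mathcal{H}$ (with $a,b\in\mathbb{R}^n$) and each integer $k$ let $v_k=a+k\cdot b\in\mathbb{R}^n$, and set $\mathcal{H}_{\mathbb{R}}=\{v_k: v\in\mathcal{H},\ k\in\{0,\dots,r\}\}$. Then $\mathcal{H}_{\mathbb{R}}$ is an $\frac{\epsilon}{(r+2)!}$-robust hitting set for $V(n,s,r)$.
   Context: For a real polynomial $g$ on $\mathbb{R}^m$, $\|g\|_2=(\mathbb{E}_x[g(x)^2])^{1/2}$, $x$ uniform on $[-1,1]^m$. For $f\in\mathbb{C}[x_1,\dots,x_n]$ write $f(a+\iota b)=\Re(f)(a,b)+\iota\,\Im(f)(a,b)$ with $\Re(f),\Im(f)$ real polynomials in $2n$ variables, and set $\|f\|_2=\|\Re(f)\|_2+\|\Im(f)\|_2$. A set $\mathcal{H}\subseteq\mathbb{C}^n$ is an $\epsilon$-robust hitting set for a set $S$ of polynomials if every $f\in S$ has some $v\in\mathcal{H}$ with $|f(v)|\ge\epsilon\|f\|_2$. Algebraic circuits: DAGs with leaves labeled by variables or constants, internal $+$/$\times$ gates; size = number of wires; homogeneous if every gate computes a homogeneous polynomial. With $N=\binom{n+r-1}{r}$, homogeneous degree-$r$ polynomials in $n$ variables over $\mathbb{C}$ are identified with coefficient vectors in $\mathbb{C}^N$, and $V(n,s,r)\subseteq\mathbb{C}^N$ is the closure of the set of coefficient vectors of such polynomials computed by homogeneous algebraic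 circuits over $\mathbb{C}$ of size at most $s$. *)

theory Defs
  imports
    "HOL-Analysis.Analysis"
    "HOL-Library.Poly_Mapping"
    "Graph_Theory.Digraph"
begin

section \<open>Polynomials in variables indexed by a finite type\<close>

text \<open>
  A monomial is its exponent vector, and a polynomial is a finitely supported map from
  monomials to coefficients, with the ring structure of \<^typ>\<open>'a \<Rightarrow>\<^sub>0 'b\<close>.  The number of
  variables is the cardinality of the index type.
\<close>

type_synonym ('n, 'a) mpol = "('n \<Rightarrow>\<^sub>0 nat) \<Rightarrow>\<^sub>0 'a"

definition pvar :: "'n \<Rightarrow> ('n, 'a::comm_semiring_1) mpol" where
  "pvar i = Poly_Mapping.single (Poly_Mapping.single i 1) 1"

definition pconst :: "'a \<Rightarrow> ('n, 'a::comm_semiring_1) mpol" where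
  "pconst c = Poly_Mapping.single 0 c"

text \<open>Apply \<open>h\<close> to the coefficients and substitute \<open>x i\<close> for the variable \<open>i\<close>.\<close>

definition psubst ::
  "('a::zero \<Rightarrow> 'b::comm_semiring_1) \<Rightarrow> ('n::finite \<Rightarrow> 'b) \<Rightarrow> ('n, 'a) mpol \<Rightarrow> 'b" where
  "psubst h x p =
     (\<Sum>m\<in>Poly_Mapping.keys p.
        h (Poly_Mapping.lookup p m) * (\<Prod>i\<in>UNIV. x i ^ Poly_Mapping.lookup m i))"

definition peval :: "('n::finite, 'a::comm_semiring_1) mpol \<Rightarrow> 'a ^ 'n \<Rightarrow> 'a" where
  "peval p x = psubst (\<lambda>c. c) (\<lambda>i. x $ i) p"

definition mdeg :: "('n::finite \<Rightarrow>\<^sub>0 nat) \<Rightarrow> nat" where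
  "mdeg m = (\<Sum>i\<in>UNIV. Poly_Mapping.lookup m i)"

text \<open>In particular \<open>0\<close> is homogeneous of every degree.\<close>

definition homogeneous :: "nat \<Rightarrow> ('n::finite, 'a::zero) mpol \<Rightarrow> bool" where
  "homogeneous d p \<longleftrightarrow> (\<forall>m\<in>Poly_Mapping.keys p. mdeg m = d)"


section \<open>Norms and robust hitting sets\<close>

definition real_norm2 :: "('m::finite, real) mpol \<Rightarrow> real" where
  "real_norm2 g =
     sqrt (\<integral>x. (peval g x)\<^sup>2 \<partial>uniform_measure lborel (cbox (vec (-1)) (vec 1) :: (real ^ 'm) set))"

text \<open>
  Real and imaginary part of \<open>f\<close> as real polynomials in the \<open>2n\<close> variables \<open>a\<^sub>i\<close> (indexed by
  \<open>Inl i\<close>) and \<open>b\<^sub>i\<close> (indexed by \<open>Inr i\<close>): expand \<open>f(a + \<i> b)\<close> with complex coefficients and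
  take real and imaginary parts of the coefficients.
\<close>

definition complex_split :: "('n::finite, complex) mpol \<Rightarrow> ('n + 'n, complex) mpol" where
  "complex_split f = psubst pconst (\<lambda>i. pvar (Inl i) + pconst \<i> * pvar (Inr i)) f"

definition Re_poly :: "('n::finite, complex) mpol \<Rightarrow> ('n + 'n, real) mpol" where
  "Re_poly f = Poly_Mapping.map Re (complex_split f)"

definition Im_poly :: "('n::finite, complex) mpol \<Rightarrow> ('n + 'n, real) mpol" where
  "Im_poly f = Poly_Mapping.map Im (complex_split f)"

definition norm2 :: "('n::finite, complex) mpol \<Rightarrow> real" where
  "norm2 f = real_norm2 (Re_poly f) + real_norm2 (Im_poly f)"

definition robust_hitting_set ::
  "real \<Rightarrow> (complex ^ 'n::finite) set \<Rightarrow> ('n, complex) mpol set \<Rightarrow> bool" where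
  "robust_hitting_set \<epsilon> H S \<longleftrightarrow> (\<forall>f\<in>S. \<exists>v\<in>H. cmod (peval f v) \<ge> \<epsilon> * norm2 f)"

definition real_pt :: "complex ^ 'n \<Rightarrow> int \<Rightarrow> real ^ 'n::finite" where
  "real_pt v k = (\<chi> i. Re (v $ i)) + real_of_int k *\<^sub>R (\<chi> i. Im (v $ i))"

definition real_pts :: "nat \<Rightarrow> (complex ^ 'n) set \<Rightarrow> (real ^ 'n::finite) set" where
  "real_pts r H = {real_pt v k | v k. v \<in> H \<and> k \<in> {0..int r}}"

definition complexify :: "real ^ 'n \<Rightarrow> complex ^ 'n::finite" where
  "complexify x = (\<chi> i. complex_of_real (x $ i))"


section \<open>Algebraic circuits\<close>

datatype 'n gate_label = Var_leaf 'n | Const_leaf complex | Plus_gate | Times_gate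

text \<open>
  The graph is a multigraph, so a gate may use the same input several times (squaring, say);
  each such wire is counted.  Wires run from inputs to gates.
\<close>

record 'n circuit =
  graph :: "(nat, nat) pre_digraph"
  gate_lbl :: "nat \<Rightarrow> 'n gate_label"
  out_gate :: nat

fun leaf_label :: "'n gate_label \<Rightarrow> bool" where
  "leaf_label (Var_leaf _) = True"
| "leaf_label (Const_leaf _) = True"
| "leaf_label Plus_gate = False"
| "leaf_label Times_gate = False"

definition valid_circuit :: "'n circuit \<Rightarrow> bool" where
  "valid_circuit C \<longleftrightarrow>
     fin_digraph (graph C) \<and> acyclic (arcs_ends (graph C)) \<and> out_gate C \<in> verts (graph C) \<and>
     (\<forall>v\<in>verts (graph C). leaf_label (gate_lbl C v) \<longleftrightarrow> in_arcs (graph C) v = {})"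

definition circuit_size :: "'n circuit \<Rightarrow> nat" where
  "circuit_size C = card (arcs (graph C))"

definition gate_op :: "'n circuit \<Rightarrow> (nat \<Rightarrow> ('n, complex) mpol) \<Rightarrow> nat \<Rightarrow> ('n, complex) mpol" where
  "gate_op C val v =
     (case gate_lbl C v of
        Var_leaf i \<Rightarrow> pvar i
      | Const_leaf c \<Rightarrow> pconst c
      | Plus_gate \<Rightarrow> (\<Sum>e\<in>in_arcs (graph C) v. val (tail (graph C) e))
      | Times_gate \<Rightarrow> (\<Prod>e\<in>in_arcs (graph C) v. val (tail (graph C) e)))"

text \<open>\<open>val\<close> assigns to every gate the polynomial computed there; see
  \<open>gate_values_exist\<close> and \<open>gate_values_unique\<close> below.\<close>

definition gate_values :: "'n circuit \<Rightarrow> (nat \<Rightarrow> ('n, complex) mpol) \<Rightarrow> bool" where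
  "gate_values C val \<longleftrightarrow> (\<forall>v\<in>verts (graph C). val v = gate_op C val v)"

definition homogeneous_circuit :: "'n::finite circuit \<Rightarrow> bool" where
  "homogeneous_circuit C \<longleftrightarrow>
     valid_circuit C \<and>
     (\<forall>val. gate_values C val \<longrightarrow> (\<forall>v\<in>verts (graph C). \<exists>d. homogeneous d (val v)))"

definition computes :: "'n circuit \<Rightarrow> ('n, complex) mpol \<Rightarrow> bool" where
  "computes C f \<longleftrightarrow> (\<exists>val. gate_values C val \<and> val (out_gate C) = f)"

lemma valid_circuit_wf:
  assumes "valid_circuit C"
  shows "wf (arcs_ends (graph C))"
proof -
  interpret fin_digraph "graph C" using assms by (simp add: valid_circuit_def)
  have "finite (arcs_ends (graph C))" by (simp add: arcs_ends_conv)
  then show ?thesis using assms by (simp add: valid_circuit_def finite_acyclic_wf)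
qed

lemma gate_op_cong:
  assumes "\<And>u. (u, v) \<in> arcs_ends (graph C) \<Longrightarrow> val u = val' u"
  shows "gate_op C val v = gate_op C val' v"
proof -
  have "val (tail (graph C) e) = val' (tail (graph C) e)" if "e \<in> in_arcs (graph C) v" for e
    using that by (intro assms) (auto simp: arcs_ends_conv in_arcs_def)
  then show ?thesis
    by (auto simp: gate_op_def split: gate_label.split intro!: sum.cong prod.cong)
qed

lemma gate_values_exist:
  assumes "valid_circuit C"
  shows "\<exists>val. gate_values C val"
proof -
  define val where "val = wfrec (arcs_ends (graph C)) (gate_op C)"
  have "val v = gate_op C val v" for v
  proof -
    have "val v = gate_op C (cut val (arcs_ends (graph C)) v) v"
      unfolding val_def by (subst wfrec[OF valid_circuit_wf[OF assms]]) simp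
    also have "\<dots> = gate_op C val v"
      by (rule gate_op_cong) (simp add: cut_apply)
    finally show ?thesis .
  qed
  then show ?thesis by (auto simp: gate_values_def)
qed

lemma gate_values_unique:
  assumes "valid_circuit C" "gate_values C val" "gate_values C val'" "v \<in> verts (graph C)"
  shows "val v = val' v"
  using valid_circuit_wf[OF assms(1)] assms(4)
proof (induction v rule: wf_induct_rule)
  case (less v)
  interpret fin_digraph "graph C" using assms(1) by (simp add: valid_circuit_def)
  have "gate_op C val v = gate_op C val' v"
    by (rule gate_op_cong) (use less.IH in \<open>auto simp: arcs_ends_conv\<close>)
  then show ?case using assms(2,3) less.prems by (simp add: gate_values_def)
qed


section \<open>The variety \<open>V(n, s, r)\<close>\<close>

text \<open>
  The coordinates of \<open>\<complex>\<^sup>N\<close> are the degree-\<open>r\<close> monomials in \<open>n\<close> variables, of which there are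
  \<open>N = binomial (n + r - 1) r\<close>; the closure is the Euclidean one.
\<close>

definition monomials :: "nat \<Rightarrow> ('n::finite \<Rightarrow>\<^sub>0 nat) set" where
  "monomials r = {m. mdeg m = r}"

definition coeff_space :: "nat \<Rightarrow> (('n::finite \<Rightarrow>\<^sub>0 nat) \<Rightarrow> complex) topology" where
  "coeff_space r = product_topology (\<lambda>_. euclidean) (monomials r)"

definition coeff_vec :: "nat \<Rightarrow> ('n::finite, complex) mpol \<Rightarrow> ('n \<Rightarrow>\<^sub>0 nat) \<Rightarrow> complex" where
  "coeff_vec r f = restrict (Poly_Mapping.lookup f) (monomials r)"

definition circuit_class :: "nat \<Rightarrow> nat \<Rightarrow> ('n::finite, complex) mpol set" where
  "circuit_class s r =
     {f. homogeneous r f \<and> (\<exists>C. homogeneous_circuit C \<and> circuit_size C \<le> s \<and> computes C f)}"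

definition V :: "nat \<Rightarrow> nat \<Rightarrow> ('n::finite, complex) mpol set" where
  "V s r =
     {f. homogeneous r f \<and>
         coeff_vec r f \<in> coeff_space r closure_of (coeff_vec r ` circuit_class s r)}"


section \<open>The defining identity of the real and imaginary parts\<close>

lemma psubst_superset:
  assumes "finite A" "Poly_Mapping.keys p \<subseteq> A" "h 0 = 0"
  shows "psubst h x p =
    (\<Sum>m\<in>A. h (Poly_Mapping.lookup p m) * (\<Prod>i\<in>UNIV. x i ^ Poly_Mapping.lookup m i))"
  unfolding psubst_def
  by (rule sum.mono_neutral_left) (use assms in \<open>auto simp: in_keys_iff\<close>)

lemma peval_zero [simp]: "peval 0 x = 0"
  by (simp add: peval_def psubst_def)

lemma peval_add: "peval (p + q) x = peval p x + peval q x"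
proof -
  let ?A = "Poly_Mapping.keys p \<union> Poly_Mapping.keys q"
  have *: "Poly_Mapping.keys (p + q) \<subseteq> ?A" by (rule Poly_Mapping.keys_add)
  show ?thesis unfolding peval_def
    by (subst (1 2 3) psubst_superset[where A = ?A])
       (use * in \<open>auto simp: lookup_add algebra_simps sum.distrib\<close>)
qed

lemma peval_sum: "peval (\<Sum>a\<in>A. p a) x = (\<Sum>a\<in>A. peval (p a) x)"
  by (induction A rule: infinite_finite_induct) (auto simp: peval_add)

lemma peval_single:
  "peval (Poly_Mapping.single m c) x = c * (\<Prod>i\<in>UNIV. (x $ i) ^ Poly_Mapping.lookup m i)"
  by (simp add: peval_def psubst_superset[where A = "{m}"])

lemma peval_mult:
  fixes p q :: "('n::finite, 'a::comm_semiring_1) mpol"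
  shows "peval (p * q) x = peval p x * peval q x"
proof -
  let ?s = "\<lambda>(p :: ('n, 'a) mpol) m. Poly_Mapping.single m (Poly_Mapping.lookup p m)"
  have 1: "p = (\<Sum>m\<in>Poly_Mapping.keys p. ?s p m)" for p :: "('n, 'a) mpol"
    by (rule poly_mapping_eqI)
       (auto simp: lookup_sum lookup_single when_def in_keys_iff)
  have 2: "peval (?s p m * ?s q m') x = peval (?s p m) x * peval (?s q m') x" for m m'
    by (simp add: mult_single peval_single lookup_add power_add prod.distrib mult_ac)
  have "peval (p * q) x =
    peval ((\<Sum>m\<in>Poly_Mapping.keys p. ?s p m) * (\<Sum>m\<in>Poly_Mapping.keys q. ?s q m)) x"
    using 1[of p] 1[of q] by simp
  also have "\<dots> = (\<Sum>m\<in>Poly_Mapping.keys p. peval (?s p m) x) * (\<Sum>m\<in>Poly_Mapping.keys q. peval (?s q m) x)"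
    by (simp only: sum_product peval_sum 2)
  also have "\<dots> = peval p x * peval q x"
    using 1[of p] 1[of q] by (simp flip: peval_sum)
  finally show ?thesis .
qed

lemma peval_pconst [simp]: "peval (pconst c) x = c"
  by (simp add: pconst_def peval_single)

lemma peval_pvar [simp]: "peval (pvar i) x = x $ i"
proof -
  have "(x $ j) ^ (Poly_Mapping.lookup (Poly_Mapping.single i 1) j) = (if j = i then x $ i else 1)" for j
    by (simp add: lookup_single when_def)
  then show ?thesis by (simp add: pvar_def peval_single prod.delta)
qed

lemma peval_one [simp]: "peval 1 x = 1"
  using peval_pconst[of 1 x] by (simp add: pconst_def)

lemma peval_power: "peval (p ^ k) x = peval p x ^ k"
  by (induction k) (auto simp: peval_mult)

lemma peval_prod: "peval (\<Prod>a\<in>A. p a) x = (\<Prod>a\<in>A. peval (p a) x)"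
  by (induction A rule: infinite_finite_induct) (auto simp: peval_mult)

lemma peval_complex_split:
  "peval (complex_split f) (complexify x) = peval f (\<chi> i. Complex (x $ Inl i) (x $ Inr i))"
proof -
  have "peval (pvar (Inl i) + pconst \<i> * pvar (Inr i)) (complexify x) =
      Complex (x $ Inl i) (x $ Inr i)" for i
    by (simp add: peval_add peval_mult complexify_def Complex_eq)
  then show ?thesis
    unfolding complex_split_def psubst_def
    by (simp add: peval_sum peval_mult peval_prod peval_power peval_def[of f] psubst_def)
qed

lemma peval_complexify:
  "peval q (complexify x) =
     Complex (peval (Poly_Mapping.map Re q) x) (peval (Poly_Mapping.map Im q) x)"
proof -
  let ?P = "\<lambda>m. \<Prod>i\<in>UNIV. (x $ i) ^ Poly_Mapping.lookup m i"
  have sub: "Poly_Mapping.keys (Poly_Mapping.map h q) \<subseteq> Poly_Mapping.keys q" for h :: "complex \<Rightarrow> real"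
    by (auto simp: in_keys_iff Poly_Mapping.map.rep_eq when_def)
  have ev: "peval (Poly_Mapping.map h q) x =
      (\<Sum>m\<in>Poly_Mapping.keys q. h (Poly_Mapping.lookup q m) * ?P m)" if "h 0 = 0" for h :: "complex \<Rightarrow> real"
    unfolding peval_def
    by (subst psubst_superset[where A = "Poly_Mapping.keys q"], rule finite_keys, rule sub, rule refl,
        rule sum.cong) (use that in \<open>auto simp: Poly_Mapping.map.rep_eq when_def in_keys_iff\<close>)
  have "peval q (complexify x) =
      (\<Sum>m\<in>Poly_Mapping.keys q. Poly_Mapping.lookup q m * complex_of_real (?P m))"
    by (simp add: peval_def psubst_def complexify_def)
  then show ?thesis by (simp add: complex_eq_iff ev del: of_real_prod of_real_power)
qed

lemma peval_Re_Im_poly: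
  "peval f (\<chi> i. Complex (x $ Inl i) (x $ Inr i)) =
     Complex (peval (Re_poly f) x) (peval (Im_poly f) x)"
  unfolding Re_poly_def Im_poly_def
  by (simp flip: peval_complexify add: peval_complex_split)

end

(* Along the complex line t \<mapsto> a + t b the polynomial f restricts to a univariate polynomial of
   degree at most r, so Lagrange interpolation at the nodes 0, ..., r expresses f(a + \<i> b) through
   the values f(a + k b). Since |\<i> - j| \<le> j + 1 and distinct nodes are at distance at least 1, each of
   the r + 1 interpolation weights has modulus at most (r + 1)!, and (r + 1) (r + 1)! \<le> (r + 2)!. *)
theory Submission
  imports Defs "HOL-Computational_Algebra.Polynomial"
begin

definition lagrange_weight :: "nat \<Rightarrow> nat \<Rightarrow> 'a::field_char_0 \<Rightarrow> 'a" where
  "lagrange_weight r k z = (\<Prod>j\<in>{..r} - {k}. (z - of_nat j) / (of_nat k - of_nat j))"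

text \<open>Both sides are polynomials in \<open>z\<close> of degree at most \<open>r\<close> that
  agree at the r + 1 nodes, which are distinct in characteristic 0.\<close>

lemma lagrange_interpolation:
  fixes p :: "'a::field_char_0 poly"
  assumes "degree p \<le> r"
  shows "poly p z = (\<Sum>k\<le>r. poly p (of_nat k) * lagrange_weight r k z)"
proof -
  \<comment> \<open>The weights recast as formal polynomials in \<open>z\<close>, so that degrees
    can be counted.\<close>
  define B where "B k = (\<Prod>j\<in>{..r} - {k}. smult (1 / (of_nat k - of_nat j)) [:- of_nat j, 1 :: 'a:])"
    for k
  define q where "q = (\<Sum>k\<le>r. smult (poly p (of_nat k)) (B k))"
  have poly_B: "poly (B k) x = lagrange_weight r k x" for k x
    unfolding B_def lagrange_weight_def poly_prod
    by (rule prod.cong) (simp_all flip: diff_divide_distrib)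
  have poly_q: "poly q x = (\<Sum>k\<le>r. poly p (of_nat k) * lagrange_weight r k x)" for x
    by (simp add: q_def poly_sum poly_B)
  have "degree (B k) \<le> r" if "k \<le> r" for k
  proof -
    have "degree (B k) \<le>
        (\<Sum>j\<in>{..r} - {k}. degree (smult (1 / (of_nat k - of_nat j)) [:- of_nat j, 1 :: 'a:]))"
      unfolding B_def by (rule order_trans[OF degree_prod_sum_le]) (auto simp: o_def)
    also have "\<dots> \<le> (\<Sum>j\<in>{..r} - {k}. 1)"
      by (intro sum_mono order_trans[OF degree_smult_le]) simp
    \<comment> \<open>Since k \<le> r, deleting \<open>k\<close> from the r + 1 nodes leaves exactly
      \<open>r\<close> linear factors.\<close>
    also have "\<dots> = r" using that by simp
    finally show ?thesis .
  qed
  then have "degree q \<le> r"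
    unfolding q_def by (intro degree_sum_le) (auto intro: order_trans[OF degree_smult_le])
  \<comment> \<open>For k = i every factor is 1; otherwise the factor with j = i vanishes, and it
    occurs because i \<le> r.\<close>
  have node: "lagrange_weight r k (of_nat i :: 'a) = (if k = i then 1 else 0)" if "i \<le> r" for i k
    using that by (auto simp: lagrange_weight_def intro!: prod.neutral)
  have "p = q"
  proof (rule poly_eqI_degree[where A = "of_nat ` {..r}"])
    fix x :: 'a assume "x \<in> of_nat ` {..r}"
    then show "poly p x = poly q x" by (auto simp: poly_q node if_distrib cong: if_cong)
  qed (use assms \<open>degree q \<le> r\<close> in \<open>auto simp: card_image inj_on_def\<close>)
  then show ?thesis using poly_q by metis
qed

lemma norm_lagrange_weight_imaginary_unit_le: "norm (lagrange_weight r k \<i>) \<le> fact (r + 1)"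
proof -
  have "norm (lagrange_weight r k \<i>) =
      (\<Prod>j\<in>{..r} - {k}. cmod (\<i> - of_nat j) / cmod (of_nat k - of_nat j))"
    by (simp add: lagrange_weight_def norm_divide flip: prod_norm)
  also have "\<dots> \<le> (\<Prod>j\<in>{..r} - {k}. real (Suc j))"
  proof (intro prod_mono conjI)
    fix j assume "j \<in> {..r} - {k}"
    then have "1 \<le> \<bar>int k - int j\<bar>" by auto
    moreover have "cmod (of_nat k - of_nat j) = real_of_int \<bar>int k - int j\<bar>"
      using norm_of_int[of "int k - int j", where 'a = complex] by simp
    ultimately have "1 \<le> cmod (of_nat k - of_nat j)" by linarith
    moreover have "cmod (\<i> - of_nat j) \<le> real (Suc j)"
      using norm_triangle_ineq4[of \<i> "of_nat j"] by simp
    ultimately show "cmod (\<i> - of_nat j) / cmod (of_nat k - of_nat j) \<le> real (Suc j)"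
      using frac_le[of "real (Suc j)" "cmod (\<i> - of_nat j)" 1] by simp
  qed simp
  \<comment> \<open>Putting back the factor for j = k, which is at least 1, completes the product to
    (r + 1)!. For k > r nothing was left out.\<close>
  also have "\<dots> \<le> (\<Prod>j\<le>r. real (Suc j))"
    by (intro prod_mono2) auto
  also have "\<dots> = fact (r + 1)"
    by (induction r) (simp_all add: algebra_simps)
  finally show ?thesis .
qed

text \<open>If all r + 1 node values were too small, their weighted sum could not reach the value at
  \<open>\<i>\<close>.\<close>

lemma poly_norm_imaginary_unit_le_node:
  assumes "degree p \<le> r"
  shows "\<exists>k\<le>r. cmod (poly p \<i>) \<le> fact (r + 2) * cmod (poly p (of_nat k))"
proof (rule ccontr)
  assume "\<not> ?thesis"
  then have small: "fact (r + 2) * cmod (poly p (of_nat k)) < cmod (poly p \<i>)" if "k \<le> r" for k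
    using that by (meson not_le)
  have "fact (r + 2) * cmod (poly p \<i>) =
      fact (r + 2) * cmod (\<Sum>k\<le>r. poly p (of_nat k) * lagrange_weight r k \<i>)"
    by (simp only: lagrange_interpolation[OF assms, of \<i>, symmetric])
  also have "\<dots> \<le> fact (r + 2) * (\<Sum>k\<le>r. cmod (poly p (of_nat k)) * fact (r + 1))"
    by (intro mult_left_mono sum_norm_le)
       (auto simp: norm_mult intro!: mult_left_mono norm_lagrange_weight_imaginary_unit_le[simplified])
  also have "\<dots> = (\<Sum>k\<le>r. (fact (r + 2) * cmod (poly p (of_nat k))) * fact (r + 1))"
    by (simp only: sum_distrib_left mult.assoc)
  \<comment> \<open>Strictness survives summation because \<open>{..r}\<close> is never empty, even
    for r = 0.\<close>
  also have "\<dots> < (\<Sum>k\<le>r. cmod (poly p \<i>) * fact (r + 1))"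
    by (intro sum_strict_mono mult_strict_right_mono small) auto
  also have "\<dots> = real (r + 1) * fact (r + 1) * cmod (poly p \<i>)"
    by simp
  also have "\<dots> \<le> fact (r + 2) * cmod (poly p \<i>)"
    by (intro mult_right_mono) (simp_all add: algebra_simps)
  finally show False by simp
qed

text \<open>Taking \<open>psubst\<close> with values in \<open>'a poly\<close> keeps the restriction
  to the line a + t b a formal polynomial in t, to which interpolation applies.\<close>

definition line_poly ::
  "('n::finite, 'a::comm_semiring_1) mpol \<Rightarrow> ('n \<Rightarrow> 'a) \<Rightarrow> ('n \<Rightarrow> 'a) \<Rightarrow> 'a poly" where
  "line_poly f a b = psubst (\<lambda>c. [:c:]) (\<lambda>i. [:a i, b i:]) f"

lemma poly_line_poly: "poly (line_poly f a b) t = peval f (\<chi> i. a i + t * b i)"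
  by (simp add: line_poly_def peval_def psubst_def poly_sum poly_prod)

text \<open>Each monomial of \<open>f\<close> turns into a constant times \<open>r\<close> factors
  of degree at most 1.\<close>

lemma degree_line_poly_le:
  assumes "homogeneous r f"
  shows "degree (line_poly f a b) \<le> r"
  unfolding line_poly_def psubst_def
proof (intro degree_sum_le finite_keys)
  fix m assume m: "m \<in> Poly_Mapping.keys f"
  have "degree ([:a i, b i:] ^ Poly_Mapping.lookup m i) \<le> Poly_Mapping.lookup m i" for i
    by (rule order_trans[OF degree_power_le]) simp
  then have "degree (\<Prod>i\<in>UNIV. [:a i, b i:] ^ Poly_Mapping.lookup m i) \<le> mdeg m"
    unfolding mdeg_def by (intro order_trans[OF degree_prod_sum_le] sum_mono) auto
  then show "degree ([:Poly_Mapping.lookup f m:] *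
      (\<Prod>i\<in>UNIV. [:a i, b i:] ^ Poly_Mapping.lookup m i)) \<le> r"
    using assms m by (intro order_trans[OF degree_mult_le]) (simp add: homogeneous_def)
qed

theorem mainTheorem5:
  fixes H :: "(complex ^ 'n::finite) set" and \<epsilon> :: real and s r :: nat
  assumes "robust_hitting_set \<epsilon> H (V s r)"
  shows "robust_hitting_set (\<epsilon> / fact (r + 2)) (complexify ` real_pts r H) (V s r)"
  unfolding robust_hitting_set_def
proof
  fix f :: "('n, complex) mpol" assume f: "f \<in> V s r"
  then obtain v where v: "v \<in> H" "\<epsilon> * norm2 f \<le> cmod (peval f v)"
    using assms by (auto simp: robust_hitting_set_def)
  \<comment> \<open>With real and imaginary parts of \<open>v\<close> as base point and direction, t
    = \<open>\<i>\<close> recovers \<open>v\<close> itself and t = k gives the real point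
    \<open>real_pt v k\<close>.\<close>
  define p where
    "p = line_poly f (\<lambda>i. complex_of_real (Re (v $ i))) (\<lambda>i. complex_of_real (Im (v $ i)))"
  have "degree p \<le> r"
    using f by (simp add: p_def V_def degree_line_poly_le)
  then obtain k where k: "k \<le> r" "cmod (poly p \<i>) \<le> fact (r + 2) * cmod (poly p (of_nat k))"
    using poly_norm_imaginary_unit_le_node by blast
  have "poly p \<i> = peval f v"
    by (simp add: p_def poly_line_poly flip: complex_eq)
  moreover have "poly p (of_nat k) = peval f (complexify (real_pt v (int k)))"
    by (simp add: p_def poly_line_poly complexify_def real_pt_def)
  ultimately have "\<epsilon> * norm2 f \<le> fact (r + 2) * cmod (peval f (complexify (real_pt v (int k))))"
    using v k by simp
  then have "\<epsilon> / fact (r + 2) * norm2 f \<le> cmod (peval f (complexify (real_pt v (int k))))"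
    by (simp add: pos_divide_le_eq mult.commute del: fact_Suc add_2_eq_Suc')
  moreover have "real_pt v (int k) \<in> real_pts r H"
    unfolding real_pts_def using v(1) k(1)
    by (intro CollectI exI[of _ v] exI[of _ "int k"]) simp
  ultimately show "\<exists>w\<in>complexify ` real_pts r H. \<epsilon> / fact (r + 2) * norm2 f \<le> cmod (peval f w)"
    by blast
qed

end
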